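(* Let $n,q$ be positive integers, let $\mathcal{W}\in\mathbb{R}^{n\times n}$ be symmetric positive definite, let $\mathcal{S}\in\mathbb{R}^{n\times q}$ have full column rank, and let $R\in\mathbb{R}^{n\times n}$ be symmetric. Then the problem $$\min_{E\in\mathbb{R}^{n\times n}}\ \tfrac12\operatorname{Tr}\left(\mathcal{W}^{-1}E\,\mathcal{W}^{-1}E^T\right)\quad\text{subject to}\quad E\mathcal{S}=R\mathcal{S},\quad E=E^T,$$ has a unique solution, given by $$E=\mathcal{W}\Pi R\,(I-\Pi\mathcal{W})+R\,\Pi\mathcal{W},\qquad \Pi:=\mathcal{S}(\mathcal{S}^T\mathcal{W}\mathcal{S})^{-1}\mathcal{S}^T .$$ In particular, if $G,Q\in\mathbb{R}^{n\times n}$ are symmetric and $R=Q-G$, then $$G+E=Q+(I-\mathcal{W}\Pi)(G-Q)(I-\Pi\mathcal{W}).$$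
   Context: $I$ denotes the $n\times n$ identity matrix and $\operatorname{Tr}$ the trace. The objective equals one half of the weighted squared Frobenius norm $\|\mathcal{W}^{-1/2}E\mathcal{W}^{-1/2}\|_F^2$ (for symmetric $E$). The problem is called the least change problem: given a symmetric estimate $G$ of a symmetric target matrix $Q$, one seeks the smallest symmetric update $E$ such that $(G+E)\mathcal{S}=Q\mathcal{S}$. *)

theory Defs
  imports "HOL-Analysis.Analysis"
begin

definition symmetric_matrix :: "real^'n^'n \<Rightarrow> bool" where
  "symmetric_matrix A \<longleftrightarrow> A = transpose A"

definition positive_definite :: "real^'n^'n \<Rightarrow> bool" where
  "positive_definite A \<longleftrightarrow> (\<forall>x. x \<noteq> 0 \<longrightarrow> x \<bullet> (A *v x) > 0)"

definition full_column_rank :: "real^'q^'n \<Rightarrow> bool" where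
  "full_column_rank S \<longleftrightarrow> rank S = CARD('q)"

definition least_change_objective :: "real^'n^'n \<Rightarrow> real^'n^'n \<Rightarrow> real" where
  "least_change_objective W E =
    1/2 * trace (matrix_inv W ** E ** matrix_inv W ** transpose E)"

definition least_change_feasible :: "real^'q^'n \<Rightarrow> real^'n^'n \<Rightarrow> real^'n^'n \<Rightarrow> bool" where
  "least_change_feasible S R E \<longleftrightarrow> E ** S = R ** S \<and> E = transpose E"

definition least_change_solution ::
    "real^'n^'n \<Rightarrow> real^'q^'n \<Rightarrow> real^'n^'n \<Rightarrow> real^'n^'n \<Rightarrow> bool" where
  "least_change_solution W S R E \<longleftrightarrow>
    is_arg_min (least_change_objective W) (least_change_feasible S R) E"

definition Pi_matrix :: "real^'n^'n \<Rightarrow> real^'q^'n \<Rightarrow> real^'n^'n" where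
  "Pi_matrix W S = S ** matrix_inv (transpose S ** W ** S) ** transpose S"

end

theory Submission
  imports Defs
begin

text \<open>
  Write \<open>V\<close> for the inverse of \<open>W\<close> and \<open>b X Y = trace (V X V Y\<^sup>T)\<close>, so that the objective is half the
  quadratic form of \<open>b\<close>.  Two feasible points differ by a symmetric \<open>D\<close> with \<open>D S = 0\<close>, hence
  \<open>D \<Pi> = \<Pi> D = 0\<close> because \<open>\<Pi>\<close> has the form \<open>S K S\<^sup>T\<close>.  The proposed minimiser \<open>E\<close> satisfies
  \<open>V E V = \<Pi> R (I - \<Pi> W) V + V R \<Pi>\<close>: each summand has a factor \<open>\<Pi>\<close> at one end, so \<open>b E D = 0\<close>
  by cyclicity of the trace (\<open>cross_term_zero\<close>).  Thus \<open>E\<close> is the orthogonal projection of the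
  origin onto the feasible affine space, and the objective at \<open>E + D\<close> equals its value at \<open>E\<close>
  plus its value at \<open>D\<close>; existence and uniqueness follow once \<open>b\<close> is known to be
  positive definite.

  For the latter, Gram-Schmidt for the inner product \<open>x \<bullet> W y\<close> produces a matrix \<open>U\<close> with
  \<open>U\<^sup>T W U = I\<close>, that is \<open>V = U U\<^sup>T\<close> (\<open>ex_congruent_identity\<close>).  Then \<open>b D D\<close> is the squared
  Frobenius norm of \<open>U\<^sup>T D U\<close> (\<open>least_change_objective_pos\<close>).  The factor \<open>U\<close> plays the role of
  \<open>W\<^sup>-\<^sup>1\<^sup>/\<^sup>2\<close> without recourse to a spectral decomposition.  The formula for \<open>G + E\<close> is the
  expansion of \<open>E = R - (I - W \<Pi>) R (I - \<Pi> W)\<close>.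
\<close>

section \<open>Matrix algebra\<close>

lemma matrix_add_rdistrib': "(B + C) ** A = B ** A + C ** (A :: real^'p^'m)"
  for B C :: "real^'m^'n"
  by (vector matrix_matrix_mult_def sum.distrib[symmetric] field_simps)

lemma matrix_diff_ldistrib: "A ** (B - C) = A ** B - A ** (C :: real^'p^'m)"
  for A :: "real^'m^'n"
  by (vector matrix_matrix_mult_def sum_subtractf[symmetric] field_simps)

lemma matrix_diff_rdistrib: "(B - C) ** A = B ** A - C ** (A :: real^'p^'m)"
  for B C :: "real^'m^'n"
  by (vector matrix_matrix_mult_def sum_subtractf[symmetric] field_simps)

lemma matrix_mult_zero [simp]:
  "(0 :: real^'m^'n) ** (A :: real^'p^'m) = 0" "(B :: real^'m^'n) ** (0 :: real^'p^'m) = 0"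
  by (simp_all add: matrix_matrix_mult_def vec_eq_iff)

lemma transpose_add: "transpose (A + B) = transpose A + transpose B"
  by (simp add: transpose_def vec_eq_iff)

lemma transpose_diff: "transpose (A - B) = transpose A - transpose B"
  by (simp add: transpose_def vec_eq_iff)

lemmas matrix_ring_simps = matrix_add_ldistrib matrix_add_rdistrib' matrix_diff_ldistrib
  matrix_diff_rdistrib matrix_mul_assoc

lemma matrix_inv_eqI:
  fixes A B :: "real^'n^'n"
  assumes "A ** B = mat 1"
  shows "matrix_inv A = B"
proof -
  have BA: "B ** A = mat 1"
    using assms matrix_left_right_inverse by blast
  have "A ** matrix_inv A = mat 1 \<and> matrix_inv A ** A = mat 1"
    unfolding matrix_inv_def by (rule someI[of _ B]) (simp add: assms BA)
  then show ?thesis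
    by (metis BA matrix_mul_assoc matrix_mul_lid matrix_mul_rid)
qed

lemma positive_definite_matrix_inv:
  fixes A :: "real^'n^'n"
  assumes "positive_definite A"
  shows "A ** matrix_inv A = mat 1" "matrix_inv A ** A = mat 1"
proof -
  have "x = 0" if "A *v x = 0" for x
    using assms that unfolding positive_definite_def by (metis inner_zero_right less_irrefl)
  then obtain B where "B ** A = mat 1"
    using matrix_left_invertible_ker by blast
  moreover from this have "A ** B = mat 1"
    using matrix_left_right_inverse by blast
  ultimately show "A ** matrix_inv A = mat 1" "matrix_inv A ** A = mat 1"
    using matrix_inv_eqI[of A B] by simp_all
qed

lemma transpose_matrix_inv:
  fixes A :: "real^'n^'n"
  assumes "A ** matrix_inv A = mat 1" "matrix_inv A ** A = mat 1" "transpose A = A"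
  shows "transpose (matrix_inv A) = matrix_inv A"
proof -
  have "A ** transpose (matrix_inv A) = transpose (matrix_inv A ** A)"
    by (simp add: matrix_transpose_mul assms(3))
  also have "\<dots> = mat 1"
    by (simp add: assms(2))
  finally show ?thesis
    using matrix_inv_eqI by metis
qed

section \<open>Positive definiteness of the objective\<close>

lemma trace_mult_transpose: "trace (A ** transpose A) = (\<Sum>i\<in>UNIV. \<Sum>j\<in>UNIV. (A $ i $ j)\<^sup>2)"
  for A :: "real^'m^'n"
  by (simp add: trace_def matrix_matrix_mult_def transpose_def power2_eq_square)

lemma trace_mult_transpose_pos:
  fixes A :: "real^'m^'n"
  assumes "A \<noteq> 0"
  shows "trace (A ** transpose A) > 0"
proof -
  obtain i j where ij: "A $ i $ j \<noteq> 0"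
    using assms by (metis vec_eq_iff zero_index)
  have "(\<Sum>j\<in>UNIV. (A $ i $ j)\<^sup>2) > 0"
    by (rule sum_pos2[of _ j]) (use ij in auto)
  then have "(\<Sum>i\<in>UNIV. \<Sum>j\<in>UNIV. (A $ i $ j)\<^sup>2) > 0"
    by (intro sum_pos2[of _ i]) (auto intro: sum_nonneg)
  then show ?thesis
    by (simp add: trace_mult_transpose)
qed

lemma symmetric_inner_swap:
  assumes "transpose W = W"
  shows "x \<bullet> (W *v y) = y \<bullet> (W *v (x :: real^'n))"
  by (metis assms dot_lmul_matrix inner_commute transpose_matrix_vector)

text \<open>
  Gram-Schmidt orthonormalisation for the inner product \<open>x \<bullet> W y\<close>.  The family is indexed by
  natural numbers so that its length can be the induction variable; a vector outside the span of
  the first \<open>k\<close> members exists as long as \<open>k\<close> is below the dimension.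
\<close>

lemma ex_orthonormal_family:
  fixes W :: "real^'n^'n"
  assumes sym: "transpose W = W" and pd: "positive_definite W" and "k \<le> CARD('n)"
  shows "\<exists>f :: nat \<Rightarrow> real^'n. \<forall>i<k. \<forall>j<k. f i \<bullet> (W *v f j) = (if i = j then 1 else 0)"
  using \<open>k \<le> CARD('n)\<close>
proof (induction k)
  case 0
  show ?case by simp
next
  case (Suc k)
  then obtain f :: "nat \<Rightarrow> real^'n"
    where f: "\<And>i j. i < k \<Longrightarrow> j < k \<Longrightarrow> f i \<bullet> (W *v f j) = (if i = j then 1 else 0)"
    by auto
  have "dim (f ` {..<k}) \<le> k"
    using dim_le_card'[of "f ` {..<k}"] card_image_le[of "{..<k}" f] by simp
  then have "dim (span (f ` {..<k})) \<noteq> dim (UNIV :: (real^'n) set)"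
    using Suc.prems by (simp add: dim_span)
  then obtain y where y: "y \<notin> span (f ` {..<k})"
    by (metis UNIV_eq_I)
  define z where "z = y - (\<Sum>i<k. (f i \<bullet> (W *v y)) *\<^sub>R f i)"
  have "(\<Sum>i<k. (f i \<bullet> (W *v y)) *\<^sub>R f i) \<in> span (f ` {..<k})"
    by (intro span_sum span_scale span_base) auto
  with y have "z \<noteq> 0"
    by (auto simp: z_def)
  then have zpos: "z \<bullet> (W *v z) > 0"
    using pd by (simp add: positive_definite_def)
  have orth: "z \<bullet> (W *v f j) = 0" if "j < k" for j
  proof -
    have "z \<bullet> (W *v f j) = y \<bullet> (W *v f j) - (\<Sum>i<k. (f i \<bullet> (W *v y)) * (f i \<bullet> (W *v f j)))"
      by (simp add: z_def inner_diff_left inner_sum_left)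
    also have "(\<Sum>i<k. (f i \<bullet> (W *v y)) * (f i \<bullet> (W *v f j)))
        = (\<Sum>i<k. if i = j then f j \<bullet> (W *v y) else 0)"
      using that by (intro sum.cong) (auto simp: f)
    also have "\<dots> = y \<bullet> (W *v f j)"
      using that symmetric_inner_swap[OF sym] by simp
    finally show ?thesis by simp
  qed
  define c where "c = 1 / sqrt (z \<bullet> (W *v z))"
  define g where "g = f(k := c *\<^sub>R z)"
  have cc: "c * (c * (z \<bullet> (W *v z))) = 1"
    using zpos by (simp add: c_def field_simps)
  have "g i \<bullet> (W *v g j) = (if i = j then 1 else 0)" if "i < Suc k" "j < Suc k" for i j
  proof -
    have "f i \<bullet> (W *v z) = 0" if "i < k"
      using orth[OF that] symmetric_inner_swap[OF sym] by metis
    then show ?thesis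
      using that cc orth f
      by (auto simp: g_def less_Suc_eq matrix_vector_mult_scaleR)
  qed
  then show ?case by blast
qed

text \<open>
  The columns of \<open>U\<close> are a full family orthonormal for \<open>W\<close>; only after \<open>k\<close> has reached the
  dimension can the natural-number indices be transported to the index type by a bijection.
\<close>

lemma ex_congruent_identity:
  fixes W :: "real^'n^'n"
  assumes "transpose W = W" "positive_definite W"
  obtains U :: "real^'n^'n" where "transpose U ** W ** U = mat 1"
proof -
  obtain f :: "nat \<Rightarrow> real^'n"
    where f: "\<forall>i<CARD('n). \<forall>j<CARD('n). f i \<bullet> (W *v f j) = (if i = j then 1 else 0)"
    using ex_orthonormal_family[OF assms order_refl] by blast
  obtain h :: "'n \<Rightarrow> nat" where h: "bij_betw h UNIV {..<CARD('n)}"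
    using ex_bij_betw_finite_nat[of "UNIV :: 'n set"] by (auto simp: atLeast0LessThan)
  then have hlt: "h i < CARD('n)" and hinj: "h i = h j \<longleftrightarrow> i = j" for i j
    by (auto simp: bij_betw_def inj_def)
  define U :: "real^'n^'n" where "U = (\<chi> i j. f (h j) $ i)"
  have "(transpose U ** W ** U) $ i $ j = f (h i) \<bullet> (W *v f (h j))" for i j
    by (simp add: matrix_mul_assoc[symmetric])
       (simp add: U_def matrix_matrix_mult_def transpose_def inner_vec_def matrix_vector_mult_def)
  then have "transpose U ** W ** U = mat 1"
    by (simp add: vec_eq_iff mat_def f hlt hinj)
  then show ?thesis by (rule that)
qed

text \<open>
  With \<open>V = U U\<^sup>T\<close> for the inverse of \<open>W\<close>, cyclicity turns \<open>trace (V D V D\<^sup>T)\<close> into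
  \<open>trace (F F\<^sup>T)\<close> for \<open>F = U\<^sup>T D U\<close>, and \<open>F\<close> vanishes only with \<open>D\<close> because \<open>U\<close> is invertible.
\<close>

lemma least_change_objective_pos:
  fixes W D :: "real^'n^'n"
  assumes "transpose W = W" "positive_definite W" "D \<noteq> 0"
  shows "least_change_objective W D > 0"
proof -
  obtain U :: "real^'n^'n" where U: "transpose U ** W ** U = mat 1"
    using ex_congruent_identity assms by blast
  then have "U ** (transpose U ** W) = mat 1"
    by (simp add: matrix_left_right_inverse)
  then have UW: "U ** transpose U ** W = mat 1"
    by (simp add: matrix_mul_assoc)
  then have WU: "W ** (U ** transpose U) = mat 1"
    using matrix_left_right_inverse by blast
  have inv: "matrix_inv W = U ** transpose U"
    by (rule matrix_inv_eqI[OF WU])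
  define F where "F = transpose U ** D ** U"
  have "F \<noteq> 0"
  proof
    assume "F = 0"
    have "D = (W ** (U ** transpose U)) ** D ** (U ** transpose U ** W)"
      by (simp add: WU UW)
    also have "\<dots> = W ** U ** F ** transpose U ** W"
      by (simp add: F_def matrix_mul_assoc)
    finally show False
      using \<open>F = 0\<close> \<open>D \<noteq> 0\<close> by simp
  qed
  have "trace (U ** transpose U ** D ** (U ** transpose U) ** transpose D)
      = trace (U ** (transpose U ** D ** U ** transpose U ** transpose D))"
    by (simp add: matrix_mul_assoc)
  also have "\<dots> = trace (F ** transpose F)"
    by (subst trace_mul_sym) (simp add: F_def matrix_transpose_mul matrix_mul_assoc)
  finally show ?thesis
    using trace_mult_transpose_pos[OF \<open>F \<noteq> 0\<close>]
    by (simp add: least_change_objective_def inv)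
qed

section \<open>The weighted projector and the minimiser\<close>

text \<open>
  This is where full column rank enters: it makes \<open>S\<^sup>T W S\<close> invertible, so that the inverse inside
  \<open>\<Pi>\<close> is a genuine one.
\<close>

lemma positive_definite_congruence:
  fixes W :: "real^'n^'n" and S :: "real^'q^'n"
  assumes "positive_definite W" "full_column_rank S"
  shows "positive_definite (transpose S ** W ** S)"
  unfolding positive_definite_def
proof (intro allI impI)
  fix x :: "real^'q"
  assume "x \<noteq> 0"
  have "inj ((*v) S)"
    using assms(2) by (simp add: full_column_rank_def full_rank_injective)
  then have "S *v x \<noteq> 0"
    using \<open>x \<noteq> 0\<close> by (metis injD matrix_vector_mult_0_right)
  then have "(S *v x) \<bullet> (W *v (S *v x)) > 0"
    using assms(1) by (simp add: positive_definite_def)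
  also have "(S *v x) \<bullet> (W *v (S *v x)) = x \<bullet> (transpose S *v (W *v (S *v x)))"
    by (metis dot_lmul_matrix vector_transpose_matrix)
  finally show "x \<bullet> (transpose S ** W ** S *v x) > 0"
    by (metis matrix_vector_mul_assoc)
qed

definition least_change_update ::
    "real^'n^'n \<Rightarrow> real^'q^'n \<Rightarrow> real^'n^'n \<Rightarrow> real^'n^'n" where
  "least_change_update W S R =
    W ** Pi_matrix W S ** R ** (mat 1 - Pi_matrix W S ** W) + R ** Pi_matrix W S ** W"

context
  fixes W :: "real^'n^'n" and S :: "real^'q^'n"
  assumes W: "transpose W = W" "positive_definite W" and S: "full_column_rank S"
begin

lemma transpose_Pi_matrix: "transpose (Pi_matrix W S) = Pi_matrix W S"
proof -
  have "transpose (matrix_inv (transpose S ** W ** S)) = matrix_inv (transpose S ** W ** S)"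
    using positive_definite_matrix_inv[OF positive_definite_congruence[OF W(2) S]]
    by (intro transpose_matrix_inv) (simp_all add: matrix_transpose_mul matrix_mul_assoc W(1))
  then show ?thesis
    by (simp add: Pi_matrix_def matrix_transpose_mul matrix_mul_assoc)
qed

lemma Pi_matrix_fixes: "Pi_matrix W S ** W ** S = S"
proof -
  let ?M = "transpose S ** W ** S"
  have "Pi_matrix W S ** W ** S = S ** (matrix_inv ?M ** ?M)"
    by (simp add: Pi_matrix_def matrix_mul_assoc)
  then show ?thesis
    using positive_definite_matrix_inv[OF positive_definite_congruence[OF W(2) S]] by simp
qed

lemma Pi_matrix_annihilates:
  fixes D :: "real^'n^'n"
  assumes "D ** S = 0" "transpose D = D"
  shows "D ** Pi_matrix W S = 0" "Pi_matrix W S ** D = 0"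
proof -
  show 1: "D ** Pi_matrix W S = 0"
    using assms(1) by (simp add: Pi_matrix_def matrix_mul_assoc)
  have "Pi_matrix W S ** D = transpose (D ** Pi_matrix W S)"
    by (simp add: matrix_transpose_mul assms(2) transpose_Pi_matrix)
  then show "Pi_matrix W S ** D = 0"
    unfolding 1 by (simp add: transpose_def vec_eq_iff)
qed

lemma least_change_update_feasible:
  assumes "transpose R = R"
  shows "least_change_feasible S R (least_change_update W S R)"
proof -
  let ?P = "Pi_matrix W S"
  have "(mat 1 - ?P ** W) ** S = 0" "R ** ?P ** W ** S = R ** S"
    using Pi_matrix_fixes by (simp_all add: matrix_diff_rdistrib matrix_mul_assoc[symmetric])
  then have "least_change_update W S R ** S = R ** S"
    by (simp add: least_change_update_def matrix_add_rdistrib' matrix_mul_assoc[symmetric])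
  moreover have "transpose (least_change_update W S R) = least_change_update W S R"
    by (simp add: least_change_update_def transpose_add transpose_diff matrix_transpose_mul
        matrix_ring_simps transpose_Pi_matrix W(1) assms)
  ultimately show ?thesis
    by (simp add: least_change_feasible_def)
qed

text \<open>
  The first-order optimality condition: the gradient of the objective at the update is
  orthogonal to every feasible direction \<open>D\<close>.
\<close>

lemma cross_term_zero:
  assumes D: "D ** S = 0" "transpose D = D"
  shows "trace (matrix_inv W ** least_change_update W S R ** matrix_inv W ** D) = 0"
proof -
  let ?V = "matrix_inv W" and ?P = "Pi_matrix W S"
  let ?X = "R ** (mat 1 - ?P ** W) ** ?V"
  have VW: "?V ** W = mat 1" and WV: "W ** ?V = mat 1"
    using positive_definite_matrix_inv[OF W(2)] by simp_all
  have "?V ** least_change_update W S R ** ?V ** D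
      = (?V ** W) ** ?P ** ?X ** D + ?V ** R ** ?P ** (W ** ?V) ** D"
    by (simp add: least_change_update_def matrix_add_ldistrib matrix_add_rdistrib' matrix_mul_assoc)
  also have "\<dots> = ?P ** (?X ** D) + ?V ** R ** (?P ** D)"
    unfolding VW WV by (simp add: matrix_mul_assoc)
  also have "\<dots> = ?P ** (?X ** D)"
    by (simp add: Pi_matrix_annihilates[OF D])
  also have "trace \<dots> = trace (?X ** (D ** ?P))"
    by (subst trace_mul_sym) (simp add: matrix_mul_assoc)
  also have "\<dots> = 0"
    by (simp add: Pi_matrix_annihilates[OF D] trace_def)
  finally show ?thesis .
qed

text \<open>Pythagoras in the weighted Frobenius inner product.\<close>

lemma least_change_objective_decomp:
  assumes R: "transpose R = R" and D: "D ** S = 0" "transpose D = D"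
  shows "least_change_objective W (least_change_update W S R + D)
    = least_change_objective W (least_change_update W S R) + least_change_objective W D"
proof -
  let ?V = "matrix_inv W" and ?E = "least_change_update W S R"
  have E: "transpose ?E = ?E"
    using least_change_update_feasible[OF R] by (simp add: least_change_feasible_def)
  have "trace (?V ** D ** ?V ** ?E) = trace (?V ** ?E ** ?V ** D)"
    using trace_mul_sym[of "?V ** D" "?V ** ?E"] by (simp add: matrix_mul_assoc)
  then show ?thesis
    using cross_term_zero[OF D, of R]
    by (simp add: least_change_objective_def transpose_add E D(2) matrix_add_ldistrib
        matrix_add_rdistrib' trace_add algebra_simps)
qed

lemma least_change_objective_less:
  assumes R: "transpose R = R" and E': "least_change_feasible S R E'" "E' \<noteq> least_change_update W S R"
  shows "least_change_objective W (least_change_update W S R) < least_change_objective W E'"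
proof -
  define D where "D = E' - least_change_update W S R"
  have "D ** S = 0" "transpose D = D"
    using E'(1) least_change_update_feasible[OF R]
    by (simp_all add: D_def least_change_feasible_def matrix_diff_rdistrib transpose_diff)
  moreover have "D \<noteq> 0"
    using E'(2) by (simp add: D_def)
  moreover have "E' = least_change_update W S R + D"
    by (simp add: D_def)
  ultimately show ?thesis
    using least_change_objective_decomp[OF R] least_change_objective_pos[OF W] by simp
qed

lemma least_change_solution_iff:
  assumes R: "transpose R = R"
  shows "least_change_solution W S R E \<longleftrightarrow> E = least_change_update W S R"
  using least_change_update_feasible[OF R] least_change_objective_less[OF R]
  unfolding least_change_solution_def is_arg_min_linorder by (metis less_eq_real_def not_less)

end

theorem mainTheorem1:
  fixes W R :: "real^'n^'n" and S :: "real^'q^'n"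
  assumes "symmetric_matrix W" and "positive_definite W"
    and "full_column_rank S"
    and "symmetric_matrix R"
  shows "\<exists>E. E = W ** Pi_matrix W S ** R ** (mat 1 - Pi_matrix W S ** W)
                + R ** Pi_matrix W S ** W
    \<and> least_change_solution W S R E
    \<and> (\<forall>E'. least_change_solution W S R E' \<longrightarrow> E' = E)
    \<and> (\<forall>G Q. symmetric_matrix G \<and> symmetric_matrix Q \<and> R = Q - G \<longrightarrow>
          G + E = Q + (mat 1 - W ** Pi_matrix W S) ** (G - Q) ** (mat 1 - Pi_matrix W S ** W))"
proof -
  let ?P = "Pi_matrix W S" and ?E = "least_change_update W S R"
  have W: "transpose W = W" and R: "transpose R = R"
    using assms(1,4) by (simp_all add: symmetric_matrix_def)
  have E: "?E = W ** ?P ** R ** (mat 1 - ?P ** W) + R ** ?P ** W"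
    using least_change_update_def .
  have "G + ?E = Q + (mat 1 - W ** ?P) ** (G - Q) ** (mat 1 - ?P ** W)" if "R = Q - G" for G Q
    unfolding E unfolding that by (simp add: matrix_ring_simps)
  then show ?thesis
    using least_change_solution_iff[OF W assms(2,3) R] E by blast
qed

end
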